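(* Let $0<\lambda<n$. The Hardy-Littlewood maximal operator $M$ is not bounded on the Zygmund-Morrey space $\mathcal{M}_{L(1+\log^+L),\lambda}(\mathbb{R}^n)$; that is, there is no constant $c>0$ such that $\|Mf\|_{\mathcal{M}_{L(1+\log^+L),\lambda}}\le c\,\|f\|_{\mathcal{M}_{L(1+\log^+L),\lambda}}$ for all $f\in\mathcal{M}_{L(1+\log^+L),\lambda}(\mathbb{R}^n)$.
   Context: Cubes in $\mathbb{R}^n$ have sides parallel to the coordinate axes; $\log^+t=\max\{\log t,0\}$. $M$ is the Hardy-Littlewood maximal operator $Mf(x)=\sup_{Q\ni x}\frac1{|Q|}\int_Q|f(y)|\,dy$ (supremum over all cubes containing $x$). For a cube $Q$ and measurable $g$, $\|g\|_{L(1+\log^+L),Q}:=\inf\{\alpha>0:\frac1{|Q|}\int_Q\frac{|g(x)|}{\alpha}\left(1+\log^+\frac{|g(x)|}{\alpha}\right)dx\le1\}$. For measurable $f$ on $\mathbb{R}^n$, $\|f\|_{\mathcal{M}_{L(1+\log^+L),\lambda}}:=\sup_Q|Q|^{\lambda/n}\|f\|_{L(1+\log^+L),Q}$ (supremum over all cubes), and $\mathcal{M}_{L(1+\log^+L),\lambda}(\mathbb{R}^n)$ (also written $\mathcal M_{L(\log L),\lambda}$) is the set of $f$ for which this is finite. *)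

theory Defs
  imports "HOL-Analysis.Analysis"
begin

text \<open>
  Cubes are closed and nondegenerate. Taking open cubes instead changes neither the
  maximal function nor the norms below.
\<close>

definition cubes :: "(real^'n) set set" where
  "cubes = {cbox a (a + (\<chi> i. l)) | a l. 0 < l}"

text \<open>
  The maximal function of a function in a Zygmund-Morrey space may be infinite at some
  points, so it takes values in \<^typ>\<open>ennreal\<close>. Accordingly the norms are defined on
  \<^typ>\<open>ennreal\<close>-valued functions \<open>g\<close>, to be read as absolute values \<open>\<bar>f\<bar>\<close>.
\<close>

definition maximal_function :: "(real^'n \<Rightarrow> real) \<Rightarrow> real^'n \<Rightarrow> ennreal" where
  "maximal_function f x =
     (SUP Q\<in>{Q\<in>cubes. x \<in> Q}.
        (\<integral>\<^sup>+y\<in>Q. ennreal \<bar>f y\<bar> \<partial>lebesgue) / emeasure lebesgue Q)"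

definition log_plus :: "ennreal \<Rightarrow> ennreal" where
  "log_plus t = (if t = \<infinity> then \<infinity> else ennreal (max (ln (enn2real t)) 0))"

definition zygmund_norm :: "(real^'n) set \<Rightarrow> (real^'n \<Rightarrow> ennreal) \<Rightarrow> ennreal" where
  "zygmund_norm Q g =
     Inf {ennreal \<alpha> | \<alpha>. 0 < \<alpha> \<and>
       (\<integral>\<^sup>+x\<in>Q. (g x / ennreal \<alpha>) * (1 + log_plus (g x / ennreal \<alpha>)) \<partial>lebesgue)
         / emeasure lebesgue Q \<le> 1}"

definition zygmund_morrey_norm :: "real \<Rightarrow> (real^'n \<Rightarrow> ennreal) \<Rightarrow> ennreal" where
  "zygmund_morrey_norm lam g =
     (SUP Q\<in>cubes. ennreal (measure lebesgue Q powr (lam / real CARD('n))) * zygmund_norm Q g)"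

definition zygmund_morrey_space :: "real \<Rightarrow> (real^'n \<Rightarrow> real) set" where
  "zygmund_morrey_space lam =
     {f \<in> borel_measurable lebesgue. zygmund_morrey_norm lam (\<lambda>x. ennreal \<bar>f x\<bar>) < \<infinity>}"

end

theory Submission
  imports Defs
begin

text \<open>
  The counterexamples are indicators \<open>f\<close> of finite grids of unit cubes. Let \<open>n\<close> be the dimension,
  \<open>K = 16 ^ m\<close>, and place a unit cube at each of the \<open>N ^ n\<close> points of \<open>K * {0..<N} ^ n\<close>.
  At scales above \<open>K\<close> the set is spread out evenly with density \<open>K ^ (- n)\<close>, and
  its Zygmund average is therefore about \<open>K ^ (- n) * ln K\<close>. Around one of the unit cubes, at distance
  \<open>s\<close> with \<open>1 \<le> s \<le> K\<close>, the maximal function has size \<open>s ^ (- n)\<close>. Its integral over one period is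
  about \<open>ln K\<close> because every dyadic scale contributes equally, and since the
  values on the scales up to \<open>2 ^ m\<close> exceed the mean by a power of \<open>K\<close>, the
  logarithm in the Zygmund norm gives one more factor \<open>ln K\<close>. So the average
  of \<open>Mf\<close> is about \<open>K ^ (- n) * (ln K)\<^sup>2\<close>, which exceeds that of \<open>f\<close> by a factor of order \<open>m\<close>.

  For the Morrey norms this loss has to be seen at the scale that dominates. The
  cube \<open>[0, K * N] ^ n\<close> gives \<open>Mf\<close> a norm of at least a constant times
  \<open>(K * N) powr lam * K ^ (- n) * m\<^sup>2\<close> (lemma \<open>zygmund_norm_maximal_grid_ge\<close>). For \<open>f\<close>,
  cubes of side at most \<open>K\<close> contribute only \<open>O(1)\<close>, because \<open>lam < n\<close>, and all others contribute
  \<open>O((K * N) powr lam * K ^ (- n) * m)\<close> (lemma \<open>morrey_norm_grid_le\<close>). Since \<open>lam > 0\<close>, the number \<open>N\<close>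
  can be taken so large that the second contribution dominates; letting \<open>m\<close> grow then rules out
  every constant.
\<close>

section \<open>Grids of unit cubes\<close>

abbreviation cube :: "real^'n \<Rightarrow> real \<Rightarrow> (real^'n) set" where
  "cube a l \<equiv> cbox a (a + (\<chi> i. l))"

definition corner :: "real \<Rightarrow> ('n \<Rightarrow> nat) \<Rightarrow> real^'n" where
  "corner K j = (\<chi> i. K * real (j i))"

definition indices :: "nat \<Rightarrow> ('n \<Rightarrow> nat) set" where
  "indices N = {j. \<forall>i. j i < N}"

definition grid :: "real \<Rightarrow> nat \<Rightarrow> (real^'n) set" where
  "grid K N = (\<Union>j\<in>indices N. cube (corner K j) 1)"

lemma mem_cube: "x \<in> cube a l \<longleftrightarrow> (\<forall>i. a $ i \<le> x $ i \<and> x $ i \<le> a $ i + l)"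
  by (simp add: mem_box_cart)

lemma measure_cube:
  fixes a :: "real^'n"
  assumes "0 \<le> l" shows "measure lebesgue (cube a l) = l ^ CARD('n)"
proof -
  have "cube a l \<noteq> {}"
    using assms by (auto simp: interval_ne_empty_cart)
  then show ?thesis by (simp add: content_cbox_cart)
qed

lemma emeasure_cube:
  fixes a :: "real^'n"
  assumes "0 \<le> l" shows "emeasure lebesgue (cube a l) = ennreal (l ^ CARD('n))"
  by (metis assms emeasure_eq_measure2 fmeasurable_cbox lmeasurable_cbox measure_cube)

lemma card_box:
  fixes S :: "'n::finite \<Rightarrow> nat set"
  shows "card {j. \<forall>i. j i \<in> S i} = (\<Prod>i\<in>UNIV. card (S i))"
proof -
  have "{j. \<forall>i. j i \<in> S i} = PiE UNIV S" by (auto simp: PiE_def)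
  then show ?thesis by (simp add: card_PiE)
qed

lemma finite_indices: "finite (indices N :: ('n::finite \<Rightarrow> nat) set)"
proof -
  have "indices N = PiE UNIV (\<lambda>i::'n. {..<N})" by (auto simp: indices_def PiE_def)
  then show ?thesis by (simp add: finite_PiE)
qed

lemma card_indices: "card (indices N :: ('n::finite \<Rightarrow> nat) set) = N ^ CARD('n)"
  using card_box[of "\<lambda>i::'n. {..<N}"] by (simp add: indices_def)

lemma card_nat_interval:
  fixes x y :: real
  assumes "x \<le> y"
  shows "finite {j::nat. x \<le> j \<and> j \<le> y}" "real (card {j::nat. x \<le> j \<and> j \<le> y}) \<le> y - x + 1"
proof -
  let ?A = "{j::nat. x \<le> j \<and> j \<le> y}"
  have sub: "int ` ?A \<subseteq> {\<lceil>x\<rceil>..\<lfloor>y\<rfloor>}"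
    by (auto simp: ceiling_le_iff le_floor_iff)
  show "finite ?A"
    using finite_subset[OF sub] by (simp add: finite_image_iff)
  have "card ?A = card (int ` ?A)" by (simp add: card_image)
  also have "\<dots> \<le> nat (\<lfloor>y\<rfloor> - \<lceil>x\<rceil> + 1)" using card_mono[OF _ sub] by simp
  finally have "real (card ?A) \<le> real (nat (\<lfloor>y\<rfloor> - \<lceil>x\<rceil> + 1))" by linarith
  also have "\<dots> \<le> y - x + 1"
    using assms by (cases "\<lfloor>y\<rfloor> - \<lceil>x\<rceil> + 1 \<ge> 0") (auto, linarith+)
  finally show "real (card ?A) \<le> y - x + 1" .
qed

lemma sets_grid: "grid K N \<in> sets lebesgue"
  unfolding grid_def using finite_indices by (intro sets.finite_UN) auto

text \<open>
  In each coordinate, the unit intervals \<open>[K * j, K * j + 1]\<close> that meet a given interval of length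
  \<open>r\<close> number at most \<open>(r + 1) / K + 1\<close>. The vectors \<open>j\<close> whose unit cube meets \<open>cube a r\<close> form a
  product of such index sets, so the one-dimensional count is raised to the power of the
  dimension.
\<close>
lemma emeasure_grid_Int_cube_le:
  fixes a :: "real^'n"
  assumes K: "1 \<le> K" and r: "0 < r"
  shows "emeasure lebesgue (grid K N \<inter> cube a r)
    \<le> ennreal (min (real N) (3 * max 1 (r / K)) ^ CARD('n))"
proof -
  define S where "S i = {j::nat. j < N \<and> (\<exists>t. K * j \<le> t \<and> t \<le> K * j + 1 \<and> a $ i \<le> t \<and> t \<le> a $ i + r)}" for i
  let ?J = "{j. \<forall>i. j i \<in> S i}"
  have sub: "grid K N \<inter> cube a r \<subseteq> (\<Union>j\<in>?J. cube (corner K j) 1)"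
  proof
    fix x assume "x \<in> grid K N \<inter> cube a r"
    then obtain j where j: "j \<in> indices N" "x \<in> cube (corner K j) 1" "x \<in> cube a r"
      by (auto simp: grid_def)
    then have "j \<in> ?J" unfolding S_def indices_def mem_cube corner_def by auto
    with j show "x \<in> (\<Union>j\<in>?J. cube (corner K j) 1)" by blast
  qed
  have Sfin: "finite (S i)" for i unfolding S_def by simp
  have Sc: "real (card (S i)) \<le> min (real N) (3 * max 1 (r / K))" for i
  proof -
    have "card (S i) \<le> card {..<N}" by (intro card_mono) (auto simp: S_def)
    moreover have "real (card (S i)) \<le> 3 * max 1 (r / K)"
    proof -
      let ?A = "{j::nat. (a $ i - 1) / K \<le> j \<and> j \<le> (a $ i + r) / K}"
      have le: "(a $ i - 1) / K \<le> (a $ i + r) / K"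
        using K r by (intro divide_right_mono) auto
      have "S i \<subseteq> ?A"
        using K by (auto simp: S_def field_simps)
      then have "real (card (S i)) \<le> card ?A"
        using card_mono card_nat_interval(1)[OF le] by auto
      also have "\<dots> \<le> (a $ i + r) / K - (a $ i - 1) / K + 1"
        using card_nat_interval(2)[OF le] .
      also have "\<dots> = r / K + 1 / K + 1" using K by (simp add: field_simps)
      also have "\<dots> \<le> 3 * max 1 (r / K)"
      proof -
        have "1 / K \<le> 1" using K by simp
        then show ?thesis by linarith
      qed
      finally show ?thesis .
    qed
    ultimately show ?thesis by simp
  qed
  have Jfin: "finite ?J"
    by (rule finite_subset[OF _ finite_indices[of N]]) (auto simp: S_def indices_def)
  have "emeasure lebesgue (grid K N \<inter> cube a r) \<le> emeasure lebesgue (\<Union>j\<in>?J. cube (corner K j) 1)"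
    using Jfin by (intro emeasure_mono sub sets.finite_UN) auto
  also have "\<dots> \<le> (\<Sum>j\<in>?J. emeasure lebesgue (cube (corner K j) 1))"
    using Jfin by (intro emeasure_subadditive_finite) auto
  also have "\<dots> = ennreal (card ?J)" 
    by (simp only: emeasure_cube[OF zero_le_one]) (simp add: ennreal_of_nat_eq_real_of_nat)
  also have "\<dots> = ennreal (\<Prod>i\<in>UNIV. real (card (S i)))" by (simp add: card_box)
  also have "\<dots> \<le> ennreal (\<Prod>i\<in>(UNIV::'n set). min (real N) (3 * max 1 (r / K)))"
    by (intro ennreal_leI prod_mono) (use Sc in auto)
  finally show ?thesis by simp
qed

section \<open>The norm of the indicator of a grid\<close>

text \<open>
  With \<open>h = 1 + max (ln (1 / s)) 0\<close>, the choice \<open>\<alpha> = s * h\<close> is feasible: the logarithm is taken of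
  \<open>1 / \<alpha> \<le> 1 / s\<close>, so the normalised integral is at most \<open>s * h / \<alpha> = 1\<close>. The bound is stated for
  every upper estimate \<open>s\<close> of the density of \<open>A\<close> in \<open>Q\<close>, which makes density zero harmless.
\<close>
lemma zygmund_norm_indicator_le:
  fixes A Q :: "(real^'n) set"
  assumes "A \<in> sets lebesgue" "Q \<in> sets lebesgue" and Q: "emeasure lebesgue Q = ennreal v" "0 < v"
    and s: "0 < s" and le: "emeasure lebesgue (A \<inter> Q) \<le> ennreal (s * v)"
  shows "zygmund_norm Q (\<lambda>x. ennreal \<bar>indicator A x\<bar>) \<le> ennreal (s * (1 + max (ln (1 / s)) 0))"
proof -
  define h where "h = 1 + max (ln (1 / s)) 0"
  define \<alpha> where "\<alpha> = s * h"
  have h: "1 \<le> h" unfolding h_def by simp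
  have \<alpha>: "0 < \<alpha>" "s \<le> \<alpha>" using s h by (auto simp: \<alpha>_def)
  have ln: "1 + max (ln (1 / \<alpha>)) 0 \<le> h"
  proof -
    have "ln (1 / \<alpha>) \<le> ln (1 / s)" using s \<alpha> by (simp add: frac_le)
    then show ?thesis by (auto simp: h_def)
  qed
  have inv: "1 / ennreal \<alpha> = ennreal (1 / \<alpha>)"
    using \<alpha> by (metis divide_ennreal ennreal_1 zero_le_one)
  have integrand: "(1 / ennreal \<alpha>) * (1 + log_plus (1 / ennreal \<alpha>))
      = ennreal ((1 + max (ln (1 / \<alpha>)) 0) / \<alpha>)"
  proof -
    have "log_plus (1 / ennreal \<alpha>) = ennreal (max (ln (1 / \<alpha>)) 0)"
      unfolding inv using \<alpha> by (simp add: log_plus_def)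
    then have "1 + log_plus (1 / ennreal \<alpha>) = ennreal (1 + max (ln (1 / \<alpha>)) 0)"
      by (metis ennreal_1 ennreal_plus max.cobounded2 zero_le_one)
    moreover have "ennreal (1 / \<alpha>) * ennreal (1 + max (ln (1 / \<alpha>)) 0)
        = ennreal ((1 + max (ln (1 / \<alpha>)) 0) / \<alpha>)"
      using \<alpha> by (subst ennreal_mult[symmetric]) auto
    ultimately show ?thesis unfolding inv by (simp only:)
  qed
  have eq: "(ennreal \<bar>indicator A x\<bar> / ennreal \<alpha>) * (1 + log_plus (ennreal \<bar>indicator A x\<bar> / ennreal \<alpha>)) * indicator Q x
     = ennreal ((1 + max (ln (1 / \<alpha>)) 0) / \<alpha>) * indicator (A \<inter> Q) x" for x
    using integrand by (auto simp: indicator_def)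
  have "(\<integral>\<^sup>+x\<in>Q. (ennreal \<bar>indicator A x\<bar> / ennreal \<alpha>) * (1 + log_plus (ennreal \<bar>indicator A x\<bar> / ennreal \<alpha>)) \<partial>lebesgue)
     = ennreal ((1 + max (ln (1 / \<alpha>)) 0) / \<alpha>) * emeasure lebesgue (A \<inter> Q)"
    unfolding eq using assms by (intro nn_integral_cmult_indicator) auto
  also have "\<dots> \<le> ennreal (h / \<alpha>) * ennreal (s * v)"
    using ln \<alpha> by (intro mult_mono ennreal_leI divide_right_mono le) auto
  also have "\<dots> = ennreal v"
    using \<alpha> s Q h by (simp add: \<alpha>_def ennreal_mult[symmetric])
  finally have le_v: "(\<integral>\<^sup>+x\<in>Q. (ennreal \<bar>indicator A x\<bar> / ennreal \<alpha>) * (1 + log_plus (ennreal \<bar>indicator A x\<bar> / ennreal \<alpha>)) \<partial>lebesgue) \<le> ennreal v" (is "?I \<le> _") .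
  have "?I / emeasure lebesgue Q \<le> 1"
  proof -
    have "?I / ennreal v \<le> ennreal v / ennreal v" using le_v by (rule divide_right_mono_ennreal)
    also have "\<dots> = 1" using Q by (simp add: ennreal_divide_self)
    finally show ?thesis unfolding Q(1) .
  qed
  with \<alpha> have "ennreal \<alpha> \<in> {ennreal \<alpha> | \<alpha>. 0 < \<alpha> \<and>
       (\<integral>\<^sup>+x\<in>Q. (ennreal \<bar>indicator A x\<bar> / ennreal \<alpha>) * (1 + log_plus (ennreal \<bar>indicator A x\<bar> / ennreal \<alpha>)) \<partial>lebesgue)
         / emeasure lebesgue Q \<le> 1}" by blast
  then show ?thesis unfolding zygmund_norm_def \<alpha>_def h_def by (rule Inf_lower)
qed

text \<open>
  This is \<open>ln y \<le> y - 1\<close> at \<open>y = s powr (\<beta> - 1)\<close>. For \<open>\<beta> = lam / n\<close> it lets the Morrey weight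
  absorb the logarithm: the density decays like the volume to the power \<open>-1\<close>, while the weight only
  grows like the volume to the power \<open>\<beta>\<close>.
\<close>
lemma entropy_le_powr:
  assumes "0 < s" "s \<le> 1" "0 < \<beta>" "\<beta> < (1::real)"
  shows "s * (1 + ln (1 / s)) \<le> s powr \<beta> / (1 - \<beta>)"
proof -
  have "ln (s powr (\<beta> - 1)) \<le> s powr (\<beta> - 1) - 1"
    using assms by (intro ln_le_minus_one) auto
  then have "(1 - \<beta>) * ln (1 / s) \<le> s powr (\<beta> - 1) - 1"
    using assms by (simp add: ln_powr ln_div algebra_simps)
  then have "s * ((1 - \<beta>) * ln (1 / s)) \<le> s * (s powr (\<beta> - 1) - 1)"
    using assms by (intro mult_left_mono) auto
  moreover have "s * s powr (\<beta> - 1) = s powr \<beta>"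
    using assms powr_add[of s 1 "\<beta> - 1"] by simp
  ultimately have "(1 - \<beta>) * (s * ln (1 / s)) \<le> s powr \<beta> - s"
    by (simp add: algebra_simps)
  moreover have "(1 - \<beta>) * s \<le> s" using assms by simp
  ultimately have "(1 - \<beta>) * (s * (1 + ln (1 / s))) \<le> s powr \<beta>"
    by (simp only: distrib_left mult_1_right)
  then show ?thesis using assms by (simp add: pos_le_divide_eq mult.commute)
qed


text \<open>
  A cube of side \<open>r \<le> K\<close> meets at most \<open>3 ^ n\<close> of the unit cubes, so its density is at most
  \<open>s = min 1 (3 ^ n / r ^ n)\<close>, and \<open>r powr lam * s powr (lam / n)\<close> stays bounded. For \<open>r > K\<close> the
  density is at most \<open>3 ^ n / K ^ n * v ^ n\<close>, where \<open>v\<close> measures how far the cube outgrows the grid.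
  The function \<open>t * (1 + ln (1 / t))\<close> is submultiplicative on \<open>(0, 1]\<close>, so the factor
  \<open>K ^ (- n)\<close> yields the term \<open>1 + n * ln K\<close> and the factor \<open>v ^ n\<close> is treated by
  \<open>entropy_le_powr\<close>.
\<close>
lemma morrey_norm_grid_le:
  fixes lam K :: real
  defines "n \<equiv> CARD('n::finite)"
  assumes lam: "0 < lam" "lam < n" and K: "1 \<le> K" and N: "0 < N"
  shows "zygmund_morrey_norm lam (\<lambda>x. ennreal \<bar>indicator (grid K N :: (real^'n) set) x\<bar>)
    \<le> ennreal (3 ^ n / (1 - lam / n) * max 1 ((K * N) powr lam * (1 + n * ln K) / K ^ n))"
  unfolding zygmund_morrey_norm_def
proof (rule SUP_least)
  let ?E = "grid K N :: (real^'n) set"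
  let ?T = "(K * N) powr lam * (1 + n * ln K) / K ^ n"
  define \<beta> where "\<beta> = lam / n"
  have n: "0 < n" by (simp add: n_def)
  have \<beta>: "0 < \<beta>" "\<beta> < 1" "\<beta> * n = lam" "n * \<beta> = lam" using lam n by (auto simp: \<beta>_def)
  fix Q :: "(real^'n) set" assume "Q \<in> cubes"
  then obtain a r where Q: "Q = cube a r" and r: "0 < r" by (auto simp: cubes_def)
  have powr_n: "(x ^ n) powr \<beta> = x powr lam" if "0 < x" for x :: real
    using that \<beta> by (simp add: powr_realpow[symmetric] powr_powr)
  have mQ: "measure lebesgue Q powr (lam / CARD('n)) = r powr lam"
    using r powr_n[of r] by (simp only: Q measure_cube \<beta>_def n_def less_imp_le)
  have eQ: "emeasure lebesgue Q = ennreal (r ^ n)" using r by (simp only: Q emeasure_cube n_def less_imp_le)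
  have EQ: "emeasure lebesgue (?E \<inter> Q) \<le> ennreal (min (real N) (3 * max 1 (r / K)) ^ n)"
    unfolding Q n_def using emeasure_grid_Int_cube_le[OF K r] .
  have reduce: "ennreal (measure lebesgue Q powr (lam / CARD('n))) * zygmund_norm Q (\<lambda>x. ennreal \<bar>indicator ?E x\<bar>)
     \<le> ennreal X"
    if "0 < s" "emeasure lebesgue (?E \<inter> Q) \<le> ennreal (s * r ^ n)"
      "r powr lam * (s * (1 + max (ln (1 / s)) 0)) \<le> X" for s X
  proof -
    have "zygmund_norm Q (\<lambda>x. ennreal \<bar>indicator ?E x\<bar>) \<le> ennreal (s * (1 + max (ln (1 / s)) 0))"
      using that r by (intro zygmund_norm_indicator_le[OF sets_grid _ eQ]) (auto simp: Q)
    then have "ennreal (r powr lam) * zygmund_norm Q (\<lambda>x. ennreal \<bar>indicator ?E x\<bar>)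
      \<le> ennreal (r powr lam) * ennreal (s * (1 + max (ln (1 / s)) 0))"
      by (rule mult_left_mono) simp
    also have "\<dots> = ennreal (r powr lam * (s * (1 + max (ln (1 / s)) 0)))"
      using that by (simp add: ennreal_mult)
    also have "\<dots> \<le> ennreal X" using that by (intro ennreal_leI) simp
    finally show ?thesis unfolding mQ .
  qed
  show "ennreal (measure lebesgue Q powr (lam / CARD('n))) * zygmund_norm Q (\<lambda>x. ennreal \<bar>indicator ?E x\<bar>)
     \<le> ennreal (3 ^ n / (1 - lam / n) * max 1 ?T)"
  proof (cases "r \<le> K")
    case True
    define s where "s = min 1 (3 ^ n / r ^ n)"
    have s: "0 < s" "s \<le> 1" using r by (auto simp: s_def)
    have "r / K \<le> 1" using True K by simp
    then have "emeasure lebesgue (?E \<inter> Q) \<le> ennreal (min (real N) 3 ^ n)"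
      using EQ by (simp add: max_def split: if_splits)
    also have "\<dots> \<le> ennreal (3 ^ n)" by (intro ennreal_leI power_mono) auto
    finally have "emeasure lebesgue (?E \<inter> Q) \<le> ennreal (3 ^ n)" .
    moreover have "emeasure lebesgue (?E \<inter> Q) \<le> ennreal (r ^ n)"
      unfolding eQ[symmetric] by (intro emeasure_mono) (auto simp: Q)
    ultimately have 1: "emeasure lebesgue (?E \<inter> Q) \<le> ennreal (s * r ^ n)"
      using r by (simp add: s_def min_def)
    have "r powr lam * s powr \<beta> \<le> r powr lam * (3 ^ n / r ^ n) powr \<beta>"
      using s \<beta> by (intro mult_left_mono powr_mono2) (auto simp: s_def)
    also have "\<dots> = 3 powr lam"
      using r powr_n[of r] powr_n[of 3] by (simp add: powr_divide)
    also have "\<dots> \<le> 3 powr n" using lam by (intro powr_mono) auto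
    also have "\<dots> = 3 ^ n" by (simp add: powr_realpow)
    finally have 2: "r powr lam * s powr \<beta> \<le> 3 ^ n" .
    have "max (ln (1 / s)) 0 = ln (1 / s)" using s by (simp add: max_def ln_div)
    then have "r powr lam * (s * (1 + max (ln (1 / s)) 0)) \<le> r powr lam * (s powr \<beta> / (1 - \<beta>))"
      using entropy_le_powr[OF s \<beta>(1,2)] by (intro mult_left_mono) auto
    also have "\<dots> \<le> 3 ^ n / (1 - \<beta>)"
      using 2 \<beta> by (simp add: divide_right_mono)
    also have "\<dots> \<le> 3 ^ n / (1 - \<beta>) * max 1 ?T"
      using \<beta> mult_left_mono[of 1 "max 1 ?T" "3 ^ n / (1 - \<beta>)"] by simp
    finally show ?thesis using reduce[OF s(1) 1] by (simp add: \<beta>_def)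
  next
    case False
    define v where "v = min 1 (K * N / r)"
    have v: "0 < v" "v \<le> 1" using K N r by (auto simp: v_def)
    define s where "s = 3 ^ n / K ^ n * v ^ n"
    have s: "0 < s" using v K by (auto simp: s_def)
    have "min (real N) (3 * max 1 (r / K)) \<le> 3 * (r / K) * v"
      using False K r by (auto simp: v_def min_def max_def field_simps)
    then have "min (real N) (3 * max 1 (r / K)) ^ n \<le> (3 * (r / K) * v) ^ n"
      by (intro power_mono) auto
    also have "\<dots> = s * r ^ n" by (simp add: s_def power_mult_distrib power_divide)
    finally have 1: "emeasure lebesgue (?E \<inter> Q) \<le> ennreal (s * r ^ n)"
      using EQ by (meson ennreal_leI order_trans)
    have u: "0 < v ^ n" "v ^ n \<le> 1" using v by (auto simp: power_le_one)
    have lnK: "0 \<le> n * ln K" and lnu: "0 \<le> ln (1 / v ^ n)" using K u by (auto simp: ln_div)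
    have "1 / s \<le> K ^ n * (1 / v ^ n)"
      using K u by (simp add: s_def field_simps)
    then have "ln (1 / s) \<le> ln (K ^ n * (1 / v ^ n))" using s K u by (subst ln_le_cancel_iff) auto
    also have "\<dots> = n * ln K + ln (1 / v ^ n)"
    proof -
      have "0 < K ^ n" "0 < 1 / v ^ n" using K u by auto
      then have "ln (K ^ n * (1 / v ^ n)) = ln (K ^ n) + ln (1 / v ^ n)" by (rule ln_mult_pos)
      then show ?thesis using K by (simp add: ln_realpow)
    qed
    finally have "1 + max (ln (1 / s)) 0 \<le> 1 + n * ln K + ln (1 / v ^ n)"
      using lnK lnu by simp
    \<comment> \<open>this is the submultiplicativity: the two logarithms are nonnegative\<close>
    also have "\<dots> \<le> (1 + n * ln K) * (1 + ln (1 / v ^ n))"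
      using mult_nonneg_nonneg[OF lnK lnu] by (simp add: algebra_simps)
    finally have "s * (1 + max (ln (1 / s)) 0) \<le> s * ((1 + n * ln K) * (1 + ln (1 / v ^ n)))"
      using s by simp
    also have "\<dots> = 3 ^ n / K ^ n * (1 + n * ln K) * (v ^ n * (1 + ln (1 / v ^ n)))"
      by (simp add: s_def)
    also have "\<dots> \<le> 3 ^ n / K ^ n * (1 + n * ln K) * ((v ^ n) powr \<beta> / (1 - \<beta>))"
      using entropy_le_powr[OF u \<beta>(1,2)] lnK K by (intro mult_left_mono) auto
    also have "(v ^ n) powr \<beta> = v powr lam" using v powr_n by simp
    finally have "r powr lam * (s * (1 + max (ln (1 / s)) 0))
      \<le> r powr lam * (3 ^ n / K ^ n * (1 + n * ln K) * (v powr lam / (1 - \<beta>)))"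
      by (intro mult_left_mono) auto
    also have "\<dots> = 3 ^ n / (1 - \<beta>) * ((r * v) powr lam * (1 + n * ln K) / K ^ n)"
      using r v by (simp add: powr_mult mult_ac)
    also have "\<dots> \<le> 3 ^ n / (1 - \<beta>) * max 1 ?T"
    proof -
      have "r * v \<le> K * N" using r by (simp add: v_def min_def field_simps)
      then have "(r * v) powr lam \<le> (K * N) powr lam"
        using r v lam by (intro powr_mono2) auto
      then have "(r * v) powr lam * (1 + n * ln K) / K ^ n \<le> ?T"
        using lnK K by (intro divide_right_mono mult_right_mono) auto
      then show ?thesis using \<beta> by (intro mult_left_mono) auto
    qed
    finally show ?thesis using reduce[OF s 1] by (simp add: \<beta>_def)
  qed
qed

section \<open>The norm of the maximal function\<close>

text \<open>
  A lower bound on the norm only needs a minorant \<open>G\<close> of \<open>2 * g\<close> with known integral and a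
  uniform lower bound \<open>t\<close> for \<open>g\<close> on the support of \<open>G\<close>. If some \<open>\<alpha> < B\<close> were feasible, then
  \<open>g / \<alpha> \<ge> exp L\<close> on that support, so the logarithm there is at least \<open>L\<close>, and the
  normalised integral would exceed \<open>1\<close>.
\<close>
lemma zygmund_norm_ge:
  fixes g G :: "real^'n \<Rightarrow> ennreal"
  assumes G: "G \<in> borel_measurable lebesgue" "\<And>x. G x \<le> 2 * g x"
    and supp: "\<And>x. G x \<noteq> 0 \<Longrightarrow> x \<in> Q \<and> ennreal t \<le> g x"
    and int: "(\<integral>\<^sup>+x. G x \<partial>lebesgue) = ennreal I"
    and Q: "emeasure lebesgue Q = ennreal v" "0 < v"
    and B: "0 < B" "0 \<le> L" "0 \<le> I" "B * exp L \<le> t" "2 * B * v \<le> I * L"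
  shows "ennreal B \<le> zygmund_norm Q g"
  unfolding zygmund_norm_def
proof (rule Inf_greatest, clarify)
  fix \<alpha> :: real
  assume \<alpha>: "0 < \<alpha>" and le: "(\<integral>\<^sup>+x\<in>Q. (g x / ennreal \<alpha>) * (1 + log_plus (g x / ennreal \<alpha>)) \<partial>lebesgue)
         / emeasure lebesgue Q \<le> 1"
  show "ennreal B \<le> ennreal \<alpha>"
  proof (rule ccontr)
    assume "\<not> ennreal B \<le> ennreal \<alpha>"
    then have less: "\<alpha> < B" using \<alpha> by (metis ennreal_leI linorder_not_le)
    have log: "ennreal L \<le> log_plus (g x / ennreal \<alpha>)" if "G x \<noteq> 0" for x
    proof (cases "g x / ennreal \<alpha> = \<infinity>")
      case True then show ?thesis by (simp add: log_plus_def)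
    next
      case False
      have "\<alpha> * exp L \<le> t" using less B(4) by (meson exp_ge_zero less_imp_le mult_right_mono order_trans)
      then have "exp L \<le> t / \<alpha>" using \<alpha> by (simp add: field_simps)
      then have "ennreal (exp L) \<le> ennreal (t / \<alpha>)" by (rule ennreal_leI)
      also have "\<dots> = ennreal t / ennreal \<alpha>"
      proof -
        have "0 \<le> t" using B(1,4) by (meson exp_ge_zero less_imp_le mult_nonneg_nonneg order_trans)
        then show ?thesis using \<alpha> by (simp add: divide_ennreal)
      qed
      also have "\<dots> \<le> g x / ennreal \<alpha>" using supp[OF that] by (intro divide_right_mono_ennreal) simp
      finally have "ennreal (exp L) \<le> g x / ennreal \<alpha>" .
      then have "exp L \<le> enn2real (g x / ennreal \<alpha>)"
        using False by (metis enn2real_ennreal enn2real_mono exp_ge_zero infinity_ennreal_def top.not_eq_extremum)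
      then have "L \<le> ln (enn2real (g x / ennreal \<alpha>))"
        by (metis exp_gt_zero ln_exp ln_mono)
      then show ?thesis using False by (auto simp: log_plus_def intro!: ennreal_leI)
    qed
    have pt: "ennreal (L / (2 * \<alpha>)) * G x
       \<le> (g x / ennreal \<alpha>) * (1 + log_plus (g x / ennreal \<alpha>)) * indicator Q x" for x
    proof (cases "G x = 0")
      case False
      have "ennreal (L / (2 * \<alpha>)) * G x = ennreal (1 / (2 * \<alpha>)) * G x * ennreal L"
      proof -
        have "ennreal (L / (2 * \<alpha>)) = ennreal (1 / (2 * \<alpha>)) * ennreal L"
          using \<alpha> B by (subst ennreal_mult[symmetric]) auto
        then show ?thesis by (simp only: mult_ac)
      qed
      also have "\<dots> \<le> ennreal (1 / (2 * \<alpha>)) * (2 * g x) * (1 + log_plus (g x / ennreal \<alpha>))"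
        using G(2) log[OF False] by (intro mult_mono) (auto intro: order_trans add_increasing)
      also have "ennreal (1 / (2 * \<alpha>)) * (2 * g x) = g x / ennreal \<alpha>"
      proof -
        have "ennreal (1 / (2 * \<alpha>)) * (2 * g x) = (ennreal (1 / (2 * \<alpha>)) * ennreal 2) * g x"
          by (simp add: mult.assoc)
        also have "ennreal (1 / (2 * \<alpha>)) * ennreal 2 = ennreal (1 / \<alpha>)"
          using \<alpha> by (subst ennreal_mult[symmetric]) auto
        also have "\<dots> * g x = g x / ennreal \<alpha>"
          using \<alpha> by (simp add: divide_ennreal_def inverse_ennreal mult.commute inverse_eq_divide)
        finally show ?thesis .
      qed
      finally show ?thesis using supp[OF False] by simp
    qed simp
    have "ennreal (L / (2 * \<alpha>)) * ennreal I = (\<integral>\<^sup>+x. ennreal (L / (2 * \<alpha>)) * G x \<partial>lebesgue)"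
      using G(1) int by (simp add: nn_integral_cmult)
    also have "\<dots> \<le> (\<integral>\<^sup>+x\<in>Q. (g x / ennreal \<alpha>) * (1 + log_plus (g x / ennreal \<alpha>)) \<partial>lebesgue)"
      by (intro nn_integral_mono pt)
    also have "\<dots> \<le> ennreal v"
    proof -
      have "A \<le> ennreal v" if "A / ennreal v \<le> 1" for A
      proof -
        have "A = A / ennreal v * ennreal v"
          using Q by (simp add: ennreal_divide_times)
        also have "\<dots> \<le> 1 * ennreal v" using that by (rule mult_right_mono) simp
        finally show ?thesis by simp
      qed
      then show ?thesis using le unfolding Q(1) .
    qed
    finally have "ennreal (L / (2 * \<alpha>) * I) \<le> ennreal v"
      using B \<alpha> ennreal_mult[of "L / (2 * \<alpha>)" I] by simp
    then have "L / (2 * \<alpha>) * I \<le> v" using Q by (simp add: ennreal_le_iff)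
    then have "I * L \<le> 2 * \<alpha> * v" using \<alpha> by (simp add: field_simps)
    also have "\<dots> < 2 * B * v" using less Q by simp
    finally show False using B by simp
  qed
qed

lemma maximal_grid_ge:
  fixes x :: "real^'n"
  assumes "j \<in> indices N" "1 \<le> s" "x \<in> cube (corner K j) s"
  shows "ennreal ((1 / s) ^ CARD('n)) \<le> maximal_function (indicator (grid K N)) x"
proof -
  let ?Q = "cube (corner K j) s" and ?q = "cube (corner K j) 1"
  have sub: "?q \<subseteq> ?Q" using assms(2) by (auto simp: mem_cube) (smt (verit))
  have sub2: "?q \<subseteq> grid K N" using assms(1) by (auto simp: grid_def)
  have "ennreal ((1 / s) ^ CARD('n)) = ennreal 1 / ennreal (s ^ CARD('n))"
    using assms(2) by (subst divide_ennreal) (auto simp: power_divide)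
  also have "ennreal 1 = emeasure lebesgue ?q" by (simp only: emeasure_cube[OF zero_le_one] power_one)
  also have "\<dots> = (\<integral>\<^sup>+y. indicator ?q y \<partial>lebesgue)" by simp
  also have "\<dots> \<le> (\<integral>\<^sup>+y\<in>?Q. ennreal \<bar>indicator (grid K N) y\<bar> \<partial>lebesgue)"
    using sub sub2 by (intro nn_integral_mono) (auto simp: indicator_def)
  also have "ennreal (s ^ CARD('n)) = emeasure lebesgue ?Q"
    using assms(2) by (simp only: emeasure_cube)
  finally have "ennreal ((1 / s) ^ CARD('n))
     \<le> (\<integral>\<^sup>+y\<in>?Q. ennreal \<bar>indicator (grid K N) y\<bar> \<partial>lebesgue) / emeasure lebesgue ?Q"
    by (simp add: divide_right_mono_ennreal)
  also have "\<dots> \<le> maximal_function (indicator (grid K N)) x"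
  proof -
    have "?Q \<in> cubes" using assms(2) unfolding cubes_def by force
    then show ?thesis unfolding maximal_function_def using assms(3) by (intro SUP_upper) auto
  qed
  finally show ?thesis .
qed

lemma geometric_tail_le:
  fixes q :: real
  assumes "0 \<le> q" "2 * q \<le> 1"
  shows "(\<Sum>k\<le>m. if k0 \<le> k then q ^ k else 0) \<le> 2 * q ^ k0 - (if k0 \<le> m then q ^ m else 0)"
proof (induction m)
  case 0 then show ?case using assms by auto
next
  case (Suc m)
  have "2 * q * q ^ m \<le> 1 * q ^ m" using assms by (intro mult_right_mono) auto
  then show ?case using Suc by (auto simp: not_less_eq_eq le_Suc_eq split: if_splits)
qed

text \<open>
  A minorant of the maximal function near the \<open>j\<close>-th unit cube that integrates to exactly \<open>m + 1\<close>,
  each dyadic scale contributing \<open>1\<close>. The cubes are nested instead of disjoint annuli; the overlap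
  costs only the factor \<open>2\<close> of a geometric series.
\<close>
definition shells :: "real \<Rightarrow> nat \<Rightarrow> ('n \<Rightarrow> nat) \<Rightarrow> real^'n \<Rightarrow> ennreal" where
  "shells K m j x = (\<Sum>k\<le>m. ennreal ((1 / 2 ^ k) ^ CARD('n)) * indicator (cube (corner K j) (2 ^ k)) x)"

lemma borel_measurable_shells: "shells K m j \<in> borel_measurable lebesgue"
  unfolding shells_def
  by (intro borel_measurable_sum borel_measurable_times_ennreal borel_measurable_const
      borel_measurable_indicator) simp

text \<open>
  Let \<open>2 ^ k0\<close> be the first dyadic scale whose cube contains \<open>x\<close>. Then \<open>shells\<close> is a geometric
  series starting at \<open>k0\<close>, hence at most twice its first term, and that term is the
  lower bound from \<open>maximal_grid_ge\<close> at scale \<open>2 ^ k0\<close>.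
\<close>
lemma shells_le_maximal:
  fixes x :: "real^'n"
  assumes j: "j \<in> indices N"
  shows "shells K m j x \<le> 2 * maximal_function (indicator (grid K N)) x"
proof (cases "\<exists>k. x \<in> cube (corner K j) (2 ^ k)")
  case False
  then show ?thesis by (simp add: shells_def)
next
  case True
  define k0 where "k0 = (LEAST k. x \<in> cube (corner K j) (2 ^ k))"
  define q :: real where "q = (1 / 2) ^ CARD('n)"
  have x: "x \<in> cube (corner K j) (2 ^ k0)" using True unfolding k0_def by (rule LeastI_ex)
  have least: "k0 \<le> k" if "x \<in> cube (corner K j) (2 ^ k)" for k
    using that unfolding k0_def by (rule Least_le)
  have q: "0 \<le> q" "2 * q \<le> 1" "(1 / 2 ^ k) ^ CARD('n) = q ^ k" for k
  proof -
    show "0 \<le> q" by (simp add: q_def)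
    have "q \<le> (1 / 2) ^ 1" unfolding q_def by (intro power_decreasing) (auto simp: Suc_leI)
    then show "2 * q \<le> 1" by simp
    show "(1 / 2 ^ k) ^ CARD('n) = q ^ k" for k
      unfolding q_def by (metis power_commutes power_mult power_one_over mult.commute)
  qed
  have "shells K m j x \<le> (\<Sum>k\<le>m. ennreal (if k0 \<le> k then q ^ k else 0))"
    unfolding shells_def q(3) using least by (intro sum_mono) (auto simp: indicator_def)
  also have "\<dots> = ennreal (\<Sum>k\<le>m. if k0 \<le> k then q ^ k else 0)"
    using q by (intro sum_ennreal) auto
  also have "\<dots> \<le> ennreal (2 * q ^ k0)"
    using geometric_tail_le[OF q(1,2), of k0 m] q(1)
    by (intro ennreal_leI) (smt (verit) zero_le_power)
  also have "\<dots> = 2 * ennreal (q ^ k0)" using q(1) by (simp add: ennreal_mult)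
  also have "\<dots> \<le> 2 * maximal_function (indicator (grid K N)) x"
    using maximal_grid_ge[OF j _ x] by (intro mult_left_mono) (auto simp: q(3))
  finally show ?thesis .
qed

lemma shells_nonzero: "shells K m j x \<noteq> 0 \<Longrightarrow> x \<in> cube (corner K j) (2 ^ m)"
proof -
  assume "shells K m j x \<noteq> 0"
  then obtain k where k: "k \<le> m" "x \<in> cube (corner K j) (2 ^ k)"
    unfolding shells_def by (metis (no_types, lifting) atMost_iff indicator_simps(2) mult_zero_right sum.neutral)
  have "(2::real) ^ k \<le> 2 ^ m" using k by (intro power_increasing) auto
  then show ?thesis using k(2) unfolding mem_cube by (meson add_left_mono order_trans)
qed

lemma corner_unique:
  fixes x :: "real^'n"
  assumes "s < K" "x \<in> cube (corner K j) s" "x \<in> cube (corner K j') s" "0 \<le> s"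
  shows "j = j'"
proof
  fix i
  have a: "K * real (j i) \<le> x $ i" "x $ i \<le> K * real (j i) + s"
       "K * real (j' i) \<le> x $ i" "x $ i \<le> K * real (j' i) + s"
    using assms by (auto simp: mem_cube corner_def)
  have "K * real (j i) < K * (real (j' i) + 1)" "K * real (j' i) < K * (real (j i) + 1)"
    using a assms(1) by (auto simp: distrib_left)
  then have "real (j i) < real (j' i) + 1" "real (j' i) < real (j i) + 1"
    using assms(1,4) by auto
  then show "j i = j' i" by linarith
qed

text \<open>
  The lemma \<open>zygmund_norm_ge\<close> is applied to the sum of all \<open>shells\<close>, whose integral is
  \<open>N ^ n * (m + 1)\<close>. On its support \<open>Mf \<ge> 2 ^ (- m * n)\<close>, whereas the claimed bound
  \<open>B\<close> is \<open>16 ^ (- m * n)\<close> up to the factor \<open>m\<^sup>2 / 4\<close>. The ratio leaves room for \<open>exp L = 2 ^ (m * n)\<close> with a remaining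
  \<open>4 ^ (m * n)\<close> to dominate \<open>m\<^sup>2\<close>; this is why \<open>K\<close> is taken as a power of \<open>16\<close>.
\<close>
lemma zygmund_norm_maximal_grid_ge:
  fixes K :: real and m N :: nat
  defines "n \<equiv> CARD('n::finite)" and "K \<equiv> 16 ^ m"
  assumes m: "1 \<le> m" and N: "0 < N"
  shows "ennreal (m\<^sup>2 / (4 * K ^ n))
    \<le> zygmund_norm (cube (0::real^'n) (K * N)) (maximal_function (indicator (grid K N)))"
proof -
  let ?g = "maximal_function (indicator (grid K N)) :: real^'n \<Rightarrow> ennreal"
  define G where "G x = (\<Sum>j\<in>indices N. shells K m j x)" for x :: "real^'n"
  have n: "1 \<le> n" by (simp add: n_def Suc_leI)
  have K2: "(2::real) ^ m < K"
    unfolding K_def using m by (intro power_strict_mono) auto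
  then have K0: "0 < K" by (smt (verit) zero_less_power)
  \<comment> \<open>distinct periods do not interact, since \<open>2 ^ m < K\<close>\<close>
  have G_eq: "\<exists>j\<in>indices N. G x = shells K m j x \<and> shells K m j x \<noteq> 0" if nz: "G x \<noteq> 0" for x
  proof -
    obtain j where j: "j \<in> indices N" "shells K m j x \<noteq> 0"
      using nz by (auto simp: G_def finite_indices)
    have "shells K m j' x = 0" if "j' \<noteq> j" for j'
    proof (rule ccontr)
      assume "shells K m j' x \<noteq> 0"
      from corner_unique[OF K2 shells_nonzero[OF this] shells_nonzero[OF j(2)]] that
      show False by simp
    qed
    then have "G x = shells K m j x"
      unfolding G_def using j by (subst sum.remove[OF finite_indices j(1)]) auto
    then show ?thesis using j by blast
  qed
  show ?thesis
  proof (rule zygmund_norm_ge)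
    show "G \<in> borel_measurable lebesgue"
      unfolding G_def by (intro borel_measurable_sum borel_measurable_shells)
    show "G x \<le> 2 * ?g x" for x
      using G_eq[of x] shells_le_maximal by (cases "G x = 0") auto
    show "x \<in> cube 0 (K * N) \<and> ennreal ((1 / 2 ^ m) ^ n) \<le> ?g x" if nz: "G x \<noteq> 0" for x
    proof -
      obtain j where j: "j \<in> indices N" and x: "x \<in> cube (corner K j) (2 ^ m)"
        using G_eq[OF nz] shells_nonzero by blast
      have "0 \<le> x $ i \<and> x $ i \<le> K * N" for i
      proof -
        have x: "K * j i \<le> x $ i" "x $ i \<le> K * j i + 2 ^ m"
          using x by (auto simp: mem_cube corner_def)
        have "j i < N" using j by (auto simp: indices_def)
        then have "real (j i) + 1 \<le> N" by linarith
        then have "K * (real (j i) + 1) \<le> K * N" using K0 by simp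
        then have "x $ i \<le> K * N" using x K2 by (simp add: distrib_left)
        moreover have "0 \<le> K * j i" using K0 by simp
        ultimately show ?thesis using x by linarith
      qed
      then show ?thesis using maximal_grid_ge[OF j _ x] by (auto simp: mem_box_cart n_def)
    qed
    show "(\<integral>\<^sup>+x. G x \<partial>lebesgue) = ennreal (real N ^ n * (real m + 1))"
    proof -
      have one: "ennreal ((1 / 2 ^ k) ^ n) * emeasure lebesgue (cube (corner K j :: real^'n) (2 ^ k)) = 1" for k j
      proof -
        have "emeasure lebesgue (cube (corner K j :: real^'n) (2 ^ k)) = ennreal ((2 ^ k) ^ n)"
          by (simp only: emeasure_cube n_def zero_le_power zero_le_numeral)
        then show ?thesis
          by (simp add: ennreal_mult[symmetric] power_mult_distrib[symmetric])
      qed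
      have "(\<integral>\<^sup>+x. shells K m j x \<partial>lebesgue) = ennreal (real m + 1)" for j :: "'n \<Rightarrow> nat"
      proof -
        have "(\<integral>\<^sup>+x. shells K m j x \<partial>lebesgue)
           = (\<Sum>k\<le>m. ennreal ((1 / 2 ^ k) ^ n) * emeasure lebesgue (cube (corner K j) (2 ^ k)))"
          unfolding shells_def n_def
          by (subst nn_integral_sum, intro borel_measurable_times_ennreal borel_measurable_const
              borel_measurable_indicator, simp, intro sum.cong refl nn_integral_cmult_indicator, simp)
        also have "\<dots> = ennreal (real m + 1)"
          by (simp only: one) (simp add: ennreal_of_nat_eq_real_of_nat add.commute)
        finally show ?thesis .
      qed
      moreover have "(\<integral>\<^sup>+x. G x \<partial>lebesgue) = (\<Sum>j\<in>(indices N :: ('n \<Rightarrow> nat) set). \<integral>\<^sup>+x. shells K m j x \<partial>lebesgue)"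
        unfolding G_def by (rule nn_integral_sum) (rule borel_measurable_shells)
      ultimately show ?thesis
        by (simp add: card_indices n_def ennreal_of_nat_eq_real_of_nat ennreal_mult)
    qed
    show "emeasure lebesgue (cube (0::real^'n) (K * N)) = ennreal ((K * N) ^ n)"
      unfolding n_def using K0 by (intro emeasure_cube) simp
    show "0 < (K * N) ^ n" "0 < m\<^sup>2 / (4 * K ^ n)" using K0 N m by auto
    show "0 \<le> m * n * ln (2::real)" "0 \<le> real N ^ n * (real m + 1)" by auto
    show "m\<^sup>2 / (4 * K ^ n) * exp (m * n * ln 2) \<le> (1 / 2 ^ m) ^ n"
    proof -
      have "exp (m * n * ln 2) = (2::real) ^ (m * n)"
        using exp_of_nat_mult[of "m * n" "ln (2::real)"] by simp
      moreover have "K ^ n = ((2::real) ^ (m * n)) ^ 4"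
        by (simp add: K_def power_mult[symmetric] power_mult_distrib[symmetric] mult.commute[of _ 4])
          (simp add: power_mult)
      moreover have "real m * real m \<le> 4 * (2 ^ (m * n) * 2 ^ (m * n))"
      proof -
        have "real m \<le> 2 ^ m" using of_nat_less_two_power[of m] by (simp add: less_imp_le)
        also have "\<dots> \<le> 2 ^ (m * n)" using n by (intro power_increasing) auto
        finally have "real m * real m \<le> 2 ^ (m * n) * 2 ^ (m * n)" by (intro mult_mono) auto
        moreover have "0 \<le> (2::real) ^ (m * n) * 2 ^ (m * n)" by simp
        ultimately show ?thesis by linarith
      qed
      ultimately show ?thesis
        by (simp add: field_simps power_mult power2_eq_square power4_eq_xxxx power_divide)
    qed
    show "2 * (m\<^sup>2 / (4 * K ^ n)) * (K * N) ^ n \<le> real N ^ n * (real m + 1) * (m * n * ln 2)"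
    proof -
      have "2 * (m\<^sup>2 / (4 * K ^ n)) * (K * N) ^ n = real N ^ n * (m * (m * (1 * (1 / 2))))"
        using K0 by (simp add: power_mult_distrib power2_eq_square)
      also have "\<dots> \<le> real N ^ n * ((real m + 1) * (m * (n * ln 2)))"
      proof -
        have "1 / 2 \<le> ln (2::real)" using ln2_ge_two_thirds by simp
        then show ?thesis using n by (intro mult_left_mono mult_mono) auto
      qed
      finally show ?thesis by (simp add: mult_ac)
    qed
  qed
qed

section \<open>Unboundedness\<close>

theorem mainTheorem5:
  fixes lam :: real
  assumes "0 < lam" and "lam < real CARD('n::finite)"
  shows "\<not> (\<exists>c>0. \<forall>f\<in>(zygmund_morrey_space lam :: (real^'n \<Rightarrow> real) set).
    zygmund_morrey_norm lam (maximal_function f)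
      \<le> ennreal c * zygmund_morrey_norm lam (\<lambda>x. ennreal \<bar>f x\<bar>))"
proof
  assume "\<exists>c>0. \<forall>f\<in>(zygmund_morrey_space lam :: (real^'n \<Rightarrow> real) set).
    zygmund_morrey_norm lam (maximal_function f)
      \<le> ennreal c * zygmund_morrey_norm lam (\<lambda>x. ennreal \<bar>f x\<bar>)"
  then obtain c where c: "0 < c" and bound: "\<And>f. f \<in> (zygmund_morrey_space lam :: (real^'n \<Rightarrow> real) set) \<Longrightarrow>
    zygmund_morrey_norm lam (maximal_function f)
      \<le> ennreal c * zygmund_morrey_norm lam (\<lambda>x. ennreal \<bar>f x\<bar>)" by blast
  define n where "n = CARD('n)"
  define D where "D = 3 ^ n / (1 - lam / n)"
  have n: "1 \<le> n" by (simp add: n_def Suc_leI)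
  have lam: "0 < lam" "lam < n" using assms by (auto simp: n_def)
  have D: "0 < D" using lam n by (auto simp: D_def)
  obtain m :: nat where m: "20 * c * D * n + 1 < m" using reals_Archimedean2 by blast
  have m1: "1 \<le> m" using m c D by (smt (verit) mult_nonneg_nonneg of_nat_0_le_iff of_nat_1 of_nat_le_iff)
  define K :: real where "K = 16 ^ m"
  have K: "1 \<le> K" by (simp add: K_def)
  \<comment> \<open>\<open>N\<close> is chosen so that the large cubes dominate the norm of \<open>f\<close>, i.e. \<open>P \<ge> 1\<close>\<close>
  obtain N :: nat where N: "(K ^ n) powr (1 / lam) < N" using reals_Archimedean2 by blast
  have N0: "0 < N" using N by (metis not_gr_zero of_nat_0 not_less powr_ge_zero)
  define P where "P = (K * N) powr lam / K ^ n"
  have P: "1 \<le> P"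
  proof -
    have "K ^ n = ((K ^ n) powr (1 / lam)) powr lam" using K lam by (simp add: powr_powr)
    also have "\<dots> \<le> real N powr lam" using N lam by (intro powr_mono2) auto
    also have "\<dots> \<le> (K * N) powr lam"
      using K lam mult_right_mono[of 1 K "real N"] by (intro powr_mono2) auto
    finally show ?thesis using K by (simp add: P_def)
  qed
  let ?f = "indicator (grid K N) :: real^'n \<Rightarrow> real"
  have ln: "1 + n * ln K \<le> 5 * n * m"
  proof -
    have "ln K = m * (4 * ln 2)" using ln_realpow[of "2::real" 4] by (simp add: K_def ln_realpow)
    also have "\<dots> \<le> real m * (4 * 1)" using ln_2_less_1 by (intro mult_left_mono) auto
    finally have "n * ln K \<le> real n * (real m * 4)" by (intro mult_left_mono) auto
    moreover have "1 * 1 \<le> real n * real m" using n m1 by (intro mult_mono) auto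
    ultimately show ?thesis by (simp add: mult_ac)
  qed
  have "zygmund_morrey_norm lam (\<lambda>x. ennreal \<bar>?f x\<bar>)
     \<le> ennreal (D * max 1 ((K * N) powr lam * (1 + n * ln K) / K ^ n))"
    unfolding D_def n_def using lam K N0 by (intro morrey_norm_grid_le) (auto simp: n_def)
  also have "\<dots> \<le> ennreal (D * (P * (5 * n * m)))"
  proof -
    have "(K * N) powr lam * (1 + n * ln K) / K ^ n = P * (1 + n * ln K)" by (simp add: P_def)
    also have "\<dots> \<le> P * (5 * n * m)" using P by (intro mult_left_mono ln) auto
    moreover have "1 * 1 \<le> P * (5 * n * m)"
    proof -
      have "0 \<le> ln K" using K by simp
      then have "0 \<le> n * ln K" by simp
      then show ?thesis using P ln by (intro mult_mono) linarith+
    qed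
    ultimately show ?thesis using D by (intro ennreal_leI mult_left_mono) auto
  qed
  finally have upper: "zygmund_morrey_norm lam (\<lambda>x. ennreal \<bar>?f x\<bar>) \<le> ennreal (D * (P * (5 * n * m)))" .
  have "?f \<in> borel_measurable lebesgue" by (rule borel_measurable_indicator[OF sets_grid])
  moreover have "zygmund_morrey_norm lam (\<lambda>x. ennreal \<bar>?f x\<bar>) < \<infinity>"
    using upper by (rule le_less_trans) simp
  ultimately have space: "?f \<in> zygmund_morrey_space lam"
    unfolding zygmund_morrey_space_def by blast
  let ?Q = "cube (0::real^'n) (K * N)"
  have KN: "0 < K * N" using K N0 by simp
  have "ennreal (P * (m\<^sup>2 / 4)) = ennreal ((K * N) powr lam) * ennreal (m\<^sup>2 / (4 * K ^ n))"
    using K by (simp add: P_def ennreal_mult[symmetric])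
  also have "(K * N) powr lam = measure lebesgue ?Q powr (lam / CARD('n))"
  proof -
    have "measure lebesgue ?Q = (K * N) ^ n" unfolding n_def using KN by (intro measure_cube) simp
    then show ?thesis using KN n by (simp add: powr_realpow[symmetric] powr_powr n_def)
  qed
  also have "ennreal (measure lebesgue ?Q powr (lam / CARD('n))) * ennreal (m\<^sup>2 / (4 * K ^ n))
     \<le> ennreal (measure lebesgue ?Q powr (lam / CARD('n))) * zygmund_norm ?Q (maximal_function ?f)"
    using zygmund_norm_maximal_grid_ge[OF m1 N0] unfolding K_def n_def by (intro mult_left_mono) auto
  also have "\<dots> \<le> zygmund_morrey_norm lam (maximal_function ?f)"
    unfolding zygmund_morrey_norm_def
  proof (rule SUP_upper)
    show "?Q \<in> cubes" using KN unfolding cubes_def by blast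
  qed
  also have "\<dots> \<le> ennreal c * ennreal (D * (P * (5 * n * m)))"
    using bound[OF space] upper by (meson mult_left_mono order_trans zero_le)
  also have "\<dots> = ennreal (c * (D * (P * (5 * n * m))))"
    using c D P by (simp add: ennreal_mult)
  finally have "P * (m\<^sup>2 / 4) \<le> c * (D * (P * (5 * n * m)))"
    using c D P by (subst (asm) ennreal_le_iff) auto
  then have "(P * m) * m \<le> (P * m) * (20 * c * D * n)"
    by (simp add: power2_eq_square algebra_simps)
  then have "real m \<le> 20 * c * D * n" using P m1 by (subst (asm) mult_le_cancel_left_pos) auto
  then show False using m by simp
qed

end
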